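(* For every $\tau$ in the complex upper half-plane, with $q = e^{2\pi i\tau}$, we have $$\frac{1}{\Pi_{q^6}^2}\left[24\left(\sum_{n\geq 1}\frac{q^{n}}{(1-q^{n})^2}-6\sum_{n\geq 1}\frac{q^{6n}}{(1-q^{6n})^2}\right)+5\right]=5\frac{\Pi_{q^2}^3}{\Pi_{q^6}^3}+24\frac{\Pi_{q^2}^2}{\Pi_{q^6}^2}+42\frac{\Pi_{q^2}}{\Pi_{q^6}}+9\frac{\Pi_{q^6}}{\Pi_{q^2}}.$$
   Context: For $\tau$ in the complex upper half-plane $\mathbb{H}$, put $q := e^{2\pi i\tau}$ (so $|q|<1$), and for $a\in\mathbb{C}$ let $(a;q)_\infty := \prod_{n=0}^\infty (1-aq^n)$. Gosper's function is $$\Pi_q := q^{1/4}\frac{(q^2;q^2)_\infty^2}{(q;q^2)_\infty^2}.$$ Fractional powers of $q$ are interpreted as $q^{r} = e^{2\pi i r\tau}$. For a positive integer $k$, $\Pi_{q^k}$ is obtained by replacing $q$ with $q^k$ (i.e. $\tau$ with $k\tau$): $\Pi_{q^k} = q^{k/4}\,(q^{2k};q^{2k})_\infty^2/(q^k;q^{2k})_\infty^2$. *)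

theory Defs
  imports "HOL-Analysis.Analysis"
begin

definition qpoch_inf :: "complex \<Rightarrow> complex \<Rightarrow> complex" where
  "qpoch_inf a q = (\<Prod>n. 1 - a * q ^ n)"

(* The power q^r with q = exp (2 pi i tau); the branch is determined by tau,
   hence tau rather than q is the argument. *)
definition nome_pow :: "complex \<Rightarrow> real \<Rightarrow> complex" where
  "nome_pow \<tau> r = exp (2 * of_real pi * \<i> * of_real r * \<tau>)"

(* Gosper's function Pi_q as a function of tau; Pi_{q^k} is gosper_Pi (of_nat k * tau). *)
definition gosper_Pi :: "complex \<Rightarrow> complex" where
  "gosper_Pi \<tau> =
     (let q = nome_pow \<tau> 1
      in nome_pow \<tau> (1/4) * (qpoch_inf (q^2) (q^2))^2 / (qpoch_inf q (q^2))^2)"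

end

theory Submission
  imports Defs "HOL-Complex_Analysis.Complex_Analysis"
begin

text \<open>
  Write \<open>[a] = (a;p)\<^sub>\<infinity> (p/a;p)\<^sub>\<infinity>\<close> and \<open>W\<^sub>p(a) = \<Sum>n\<in>\<int>. a p\<^sup>n / (1 - a p\<^sup>n)\<^sup>2\<close>. The classical factorisation
  \<open>W\<^sub>p(a) - W\<^sub>p(b) = (p;p)\<^sub>\<infinity>\<^sup>4 a [ab] [b/a] / ([a]\<^sup>2 [b]\<^sup>2)\<close>
  holds because the difference of the two sides is invariant under \<open>a \<mapsto> a p\<close>, has no poles, and
  vanishes at \<open>a = b\<close>. With \<open>A = \<Pi>(q\<^sup>2)\<close>, \<open>B = \<Pi>(q\<^sup>6)\<close>, \<open>Q = q\<^sup>2\<close> and \<open>\<omega>\<close> a primitive cube root of unity,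
  four instances of it are
  \<open>2 A\<^sup>2 = W(q) - W(-q)\<close> for \<open>p = q\<^sup>4\<close>,
  \<open>A B = W(Q) - W(Q\<^sup>3)\<close> and \<open>B\<^sup>3/A = W(Q\<^sup>2) - W(Q\<^sup>3)\<close> for \<open>p = Q\<^sup>6\<close>, and
  \<open>A\<^sup>3/B = -3 (W(\<omega>) - W(Q))\<close> for \<open>p = Q\<^sup>2\<close>.
  Splitting the summation index into residue classes turns each right-hand side into a combination of the
  series \<open>\<Sum>n\<ge>1. q\<^sup>k\<^sup>n / (1 - q\<^sup>k\<^sup>n)\<^sup>2\<close> with \<open>k\<close> dividing 12, and in the linear combination on the
  right of the theorem, multiplied by \<open>B\<^sup>2\<close>, only \<open>k = 1\<close> and \<open>k = 6\<close> survive.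
\<close>

section \<open>The infinite product\<close>

lemma convergent_prod_qpoch:
  fixes a q :: complex
  assumes "norm q < 1"
  shows "convergent_prod (\<lambda>n. 1 - a * q ^ n)"
proof (rule abs_convergent_prod_imp_convergent_prod)
  have "summable (\<lambda>n. norm a * norm q ^ n)"
    using assms by (intro summable_mult summable_geometric) auto
  then show "abs_convergent_prod (\<lambda>n. 1 - a * q ^ n)"
    by (simp add: abs_convergent_prod_conv_summable norm_mult norm_power)
qed

lemma qpoch_inf_LIMSEQ:
  assumes "norm q < 1"
  shows "(\<lambda>N. \<Prod>n<N. 1 - a * q ^ n) \<longlonglongrightarrow> qpoch_inf a q"
  using convergent_prod_LIMSEQ[OF convergent_prod_qpoch[OF assms, of a]]
  by (simp add: qpoch_inf_def LIMSEQ_lessThan_iff_atMost)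

lemma qpoch_inf_nonzero:
  assumes "norm q < 1" "\<And>n. a * q ^ n \<noteq> 1"
  shows "qpoch_inf a q \<noteq> 0"
  unfolding qpoch_inf_def using assms
  by (intro prodinf_nonzero convergent_prod_qpoch) auto

lemma qpoch_inf_nonzero':
  assumes "norm q < 1" "norm a < 1"
  shows "qpoch_inf a q \<noteq> 0"
proof (rule qpoch_inf_nonzero[OF assms(1)])
  fix n
  have "norm (a * q ^ n) \<le> norm a * 1"
    unfolding norm_mult norm_power using assms by (intro mult_left_mono power_le_one) auto
  then show "a * q ^ n \<noteq> 1"
    using assms by force
qed

text \<open>The index is split by its residue mod \<open>k\<close>; the regrouped partial product
  has \<open>N * k\<close> factors, which is a subsequence with the same limit.\<close>

lemma qpoch_inf_dissect:
  assumes q: "norm q < 1" and "k > 0"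
  shows "qpoch_inf a q = (\<Prod>i<k. qpoch_inf (a * q ^ i) (q ^ k))"
proof (rule LIMSEQ_unique)
  have "norm (q ^ k) < 1"
    using assms by (simp add: norm_power power_less_one_iff)
  then show "(\<lambda>N. \<Prod>i<k. \<Prod>n<N. 1 - a * q ^ i * (q ^ k) ^ n)
      \<longlonglongrightarrow> (\<Prod>i<k. qpoch_inf (a * q ^ i) (q ^ k))"
    by (intro tendsto_prod qpoch_inf_LIMSEQ)
  have *: "(\<Prod>i<k. \<Prod>n<N. 1 - a * q ^ i * (q ^ k) ^ n) = (\<Prod>n<N * k. 1 - a * q ^ n)" for N
  proof -
    have "(\<Prod>i<k. \<Prod>n<N. 1 - a * q ^ i * (q ^ k) ^ n)
        = (\<Prod>n<N. \<Prod>i<k. 1 - a * q ^ (i + n * k))"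
      by (subst prod.swap) (simp add: power_add mult_ac flip: power_mult)
    also have "\<dots> = (\<Prod>n<N. \<Prod>i\<in>{n * k..<n * k + k}. 1 - a * q ^ i)"
    proof (rule prod.cong[OF refl])
      fix n
      show "(\<Prod>i<k. 1 - a * q ^ (i + n * k)) = (\<Prod>i\<in>{n * k..<n * k + k}. 1 - a * q ^ i)"
        using prod.shift_bounds_nat_ivl[of "\<lambda>i. 1 - a * q ^ i" 0 "n * k" k]
        by (simp add: atLeast0LessThan add.commute)
    qed
    also have "\<dots> = (\<Prod>n<N * k. 1 - a * q ^ n)"
      by (rule prod.nat_group)
    finally show ?thesis .
  qed
  show "(\<lambda>N. \<Prod>i<k. \<Prod>n<N. 1 - a * q ^ i * (q ^ k) ^ n) \<longlonglongrightarrow> qpoch_inf a q"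
    unfolding * using \<open>k > 0\<close>
    by (intro filterlim_compose[OF qpoch_inf_LIMSEQ[OF q]] mult_nat_right_at_top) auto
qed

lemma qpoch_inf_bisect:
  assumes "norm q < 1"
  shows "qpoch_inf a q = qpoch_inf a (q ^ 2) * qpoch_inf (a * q) (q ^ 2)"
  using qpoch_inf_dissect[OF assms, of 2 a] by (simp add: eval_nat_numeral)

lemma qpoch_inf_trisect:
  assumes "norm q < 1"
  shows "qpoch_inf a q = qpoch_inf a (q ^ 3) * qpoch_inf (a * q) (q ^ 3) * qpoch_inf (a * q ^ 2) (q ^ 3)"
  using qpoch_inf_dissect[OF assms, of 3 a] by (simp add: eval_nat_numeral)

lemma qpoch_inf_rec:
  assumes "norm q < 1"
  shows "qpoch_inf a q = (1 - a) * qpoch_inf (a * q) q"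
proof (rule LIMSEQ_unique[OF LIMSEQ_Suc[OF qpoch_inf_LIMSEQ[OF assms]]])
  have "(\<Prod>n<Suc N. 1 - a * q ^ n) = (1 - a) * (\<Prod>n<N. 1 - a * q * q ^ n)" for N
    by (subst prod.lessThan_Suc_shift) (simp add: mult_ac)
  then show "(\<lambda>N. \<Prod>n<Suc N. 1 - a * q ^ n) \<longlonglongrightarrow> (1 - a) * qpoch_inf (a * q) q"
    using tendsto_mult[OF tendsto_const qpoch_inf_LIMSEQ[OF assms], of "1 - a" "a * q"]
    by simp
qed

lemma qpoch_inf_one [simp]: "norm q < 1 \<Longrightarrow> qpoch_inf 1 q = 0"
  by (subst qpoch_inf_rec) auto

lemma qpoch_inf_mult_neg:
  assumes "norm q < 1"
  shows "qpoch_inf a q * qpoch_inf (-a) q = qpoch_inf (a ^ 2) (q ^ 2)"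
proof -
  have "(1 - a * q ^ n) * (1 - (-a) * q ^ n) = 1 - a ^ 2 * (q ^ 2) ^ n" for n
    by (simp add: power_even_eq power2_eq_square algebra_simps power_mult_distrib)
  then show ?thesis
    unfolding qpoch_inf_def
    by (subst prodinf_mult[OF convergent_prod_qpoch convergent_prod_qpoch]) (auto simp: assms)
qed

text \<open>The hypothesis makes \<open>w\<close> a primitive cube root of unity, so each triple of
  factors is the factorisation of \<open>1 - x ^ 3\<close>.\<close>

lemma qpoch_inf_mult_cubic:
  assumes q: "norm q < 1" and w: "w ^ 2 + w + 1 = 0"
  shows "qpoch_inf a q * qpoch_inf (w * a) q * qpoch_inf (w ^ 2 * a) q = qpoch_inf (a ^ 3) (q ^ 3)"
proof -
  have "(1 - x) * (1 - w * x) * (1 - w ^ 2 * x) = 1 - x ^ 3" for x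
    using w by algebra
  from this[of "a * q ^ n" for n]
  have eq: "(1 - a * q ^ n) * (1 - w * a * q ^ n) * (1 - w ^ 2 * a * q ^ n) = 1 - a ^ 3 * (q ^ 3) ^ n" for n
    by (simp add: power_mult_distrib mult_ac flip: power_mult)
  show ?thesis
    unfolding qpoch_inf_def using q
    by (simp add: prodinf_mult convergent_prod_mult convergent_prod_qpoch eq)
qed

text \<open>The partial products are polynomials in \<open>a\<close> and converge uniformly on
  closed unit discs, by the M-test.\<close>

lemma holomorphic_qpoch_inf:
  assumes q: "norm q < 1"
  shows "(\<lambda>a. qpoch_inf a q) holomorphic_on UNIV"
proof (rule holomorphic_uniform_sequence[OF open_UNIV])
  show "(\<lambda>a. \<Prod>n<N. 1 - a * q ^ n) holomorphic_on UNIV" for N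
    by (intro holomorphic_intros)
  fix x :: complex
  have "uniformly_convergent_on (cball x 1) (\<lambda>N a. \<Prod>n<N. 1 - a * q ^ n)"
  proof (rule uniformly_convergent_on_prod')
    show "uniformly_convergent_on (cball x 1) (\<lambda>N a. \<Sum>n<N. norm (1 - a * q ^ n - 1))"
    proof (rule Weierstrass_m_test'_ev)
      show "summable (\<lambda>n. (norm x + 1) * norm q ^ n)"
        using q by (intro summable_mult summable_geometric) auto
      have "norm a \<le> norm x + 1" if "a \<in> cball x 1" for a
        using that norm_triangle_ineq2[of a x] by (simp add: dist_norm norm_minus_commute)
      then show "\<forall>\<^sub>F n in sequentially. \<forall>a\<in>cball x 1. norm (norm (1 - a * q ^ n - 1)) \<le> (norm x + 1) * norm q ^ n"
        by (intro always_eventually) (auto simp: norm_mult norm_power intro!: mult_right_mono)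
    qed
  qed (auto intro!: continuous_intros)
  then obtain l where l: "uniform_limit (cball x 1) (\<lambda>N a. \<Prod>n<N. 1 - a * q ^ n) l sequentially"
    by (auto simp: uniformly_convergent_on_def)
  have "l a = qpoch_inf a q" if "a \<in> cball x 1" for a
    using tendsto_uniform_limitI[OF l that] qpoch_inf_LIMSEQ[OF q] LIMSEQ_unique by blast
  then have "uniform_limit (cball x 1) (\<lambda>N a. \<Prod>n<N. 1 - a * q ^ n) (\<lambda>a. qpoch_inf a q) sequentially"
    using l by (subst uniform_limit_cong'[where g = "\<lambda>N a. \<Prod>n<N. 1 - a * q ^ n" and i = l]) auto
  then show "\<exists>d>0. cball x d \<subseteq> UNIV \<and>
      uniform_limit (cball x d) (\<lambda>N a. \<Prod>n<N. 1 - a * q ^ n) (\<lambda>a. qpoch_inf a q) sequentially"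
    by (intro exI[of _ 1]) auto
qed

lemma holomorphic_qpoch_inf' [holomorphic_intros]:
  assumes "norm q < 1" "f holomorphic_on A"
  shows "(\<lambda>z. qpoch_inf (f z) q) holomorphic_on A"
  using holomorphic_on_compose_gen[OF assms(2) holomorphic_qpoch_inf[OF assms(1)]]
  by (simp add: o_def)

section \<open>The Lambert series\<close>

definition lambert_term :: "complex \<Rightarrow> complex" where
  "lambert_term x = x / (1 - x) ^ 2"

text \<open>One half of the bilateral series \<open>W\<close>. The free starting point
  \<open>x\<close> makes residue classes of the index expressible; \<open>x = p = q ^ k\<close>
  gives the series of the theorem.\<close>

definition lambert :: "complex \<Rightarrow> complex \<Rightarrow> complex" where
  "lambert p x = (\<Sum>n. lambert_term (x * p ^ n))"

text \<open>This symmetry turns the negative indices of the bilateral series into the one-sided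
  series \<open>lambert p (p / a)\<close>. At 0 and 1 both sides are 0 by the convention for
  division by zero.\<close>

lemma lambert_term_inverse: "lambert_term (1 / x) = lambert_term x"
  by (cases "x = 0 \<or> x = 1")
     (auto simp: lambert_term_def field_simps power2_eq_square)

lemma norm_lambert_term_le:
  assumes "norm x \<le> r" "r < 1"
  shows "norm (lambert_term x) \<le> norm x / (1 - r) ^ 2"
proof -
  have "1 - r \<le> norm (1 - x)"
    using assms norm_triangle_ineq2[of 1 x] by simp
  then have "(1 - r) ^ 2 \<le> norm (1 - x) ^ 2"
    using assms by (intro power_mono) auto
  then show ?thesis
    using assms by (auto simp: lambert_term_def norm_divide norm_power intro!: divide_left_mono mult_pos_pos zero_less_power)
qed

lemma summable_lambert:
  assumes "norm p < 1"
  shows "summable (\<lambda>n. lambert_term (x * p ^ n))"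
proof (rule summable_comparison_test_ev)
  \<comment> \<open>From some index on the argument has norm below 1/2, where the term is at most 4
    times as large as its argument.\<close>
  have lim: "(\<lambda>n. norm x * norm p ^ n) \<longlonglongrightarrow> norm x * 0"
    using assms by (intro tendsto_mult tendsto_const LIMSEQ_power_zero) auto
  have "\<forall>\<^sub>F n in sequentially. norm x * norm p ^ n < 1 / 2"
    using order_tendstoD(2)[OF lim, of "1/2"] by simp
  then show "\<forall>\<^sub>F n in sequentially. norm (lambert_term (x * p ^ n)) \<le> (norm x * norm p ^ n) * 4"
  proof eventually_elim
    case (elim n)
    then show ?case
      using norm_lambert_term_le[of "x * p ^ n" "1/2"]
      by (simp add: norm_mult norm_power power2_eq_square)
  qed
  show "summable (\<lambda>n. (norm x * norm p ^ n) * 4)"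
    using assms by (intro summable_mult2 summable_mult summable_geometric) auto
qed

lemma lambert_rec:
  assumes "norm p < 1"
  shows "lambert p x = lambert_term x + lambert p (x * p)"
  using suminf_split_head[OF summable_lambert[OF assms, of x]]
  by (simp add: lambert_def mult_ac)

lemma lambert_dissect:
  assumes "norm q < 1" "k > 0"
  shows "lambert q x = (\<Sum>i<k. lambert (q ^ k) (x * q ^ i))"
proof -
  have q: "norm (q ^ k) < 1"
    using assms by (simp add: norm_power power_less_one_iff)
  have "lambert q x = (\<Sum>n. \<Sum>i\<in>{n * k..<n * k + k}. lambert_term (x * q ^ i))"
    unfolding lambert_def
    by (intro sums_unique sums_group summable_sums summable_lambert assms)
  also have "\<dots> = (\<Sum>n. \<Sum>i<k. lambert_term (x * q ^ i * (q ^ k) ^ n))"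
  proof (intro suminf_cong)
    fix n
    show "(\<Sum>i\<in>{n * k..<n * k + k}. lambert_term (x * q ^ i)) = (\<Sum>i<k. lambert_term (x * q ^ i * (q ^ k) ^ n))"
      using sum.shift_bounds_nat_ivl[of "\<lambda>i. lambert_term (x * q ^ i)" 0 "n * k" k]
      by (simp add: atLeast0LessThan add.commute power_add mult_ac flip: power_mult)
  qed
  also have "\<dots> = (\<Sum>i<k. lambert (q ^ k) (x * q ^ i))"
    unfolding lambert_def by (intro suminf_sum summable_lambert q)
  finally show ?thesis .
qed

lemma lambert_bisect:
  assumes "norm q < 1"
  shows "lambert q x = lambert (q ^ 2) x + lambert (q ^ 2) (x * q)"
  using lambert_dissect[OF assms, of 2 x] by (simp add: eval_nat_numeral)

lemma lambert_trisect:
  assumes "norm q < 1"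
  shows "lambert q x = lambert (q ^ 3) x + lambert (q ^ 3) (x * q) + lambert (q ^ 3) (x * q ^ 2)"
  using lambert_dissect[OF assms, of 3 x] by (simp add: eval_nat_numeral)

text \<open>Near 0, \<open>lambert_term y\<close> is the power series with terms
  \<open>m * y ^ m\<close>; adding the value at \<open>-y\<close> doubles its even part, whence
  \<open>2 * 2 = 4\<close>. The hypothesis \<open>ne\<close> avoids the poles, where the default
  value 0 would break the identity.\<close>

lemma lambert_add_neg:
  assumes p: "norm p < 1" and ne: "\<And>n. (x * p ^ n) ^ 2 \<noteq> 1"
  shows "lambert p x + lambert p (-x) = 4 * lambert (p ^ 2) (x ^ 2)"
proof -
  have eq: "lambert_term y + lambert_term (-y) = 4 * lambert_term (y ^ 2)" if "y ^ 2 \<noteq> 1" for y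
  proof -
    have "1 - y \<noteq> 0" "1 + y \<noteq> 0"
      using that by (auto simp: power2_eq_1_iff eq_neg_iff_add_eq_0 add.commute)
    moreover have "1 - y ^ 2 = (1 - y) * (1 + y)"
      by (simp add: power2_eq_square algebra_simps)
    ultimately show ?thesis
      by (simp add: lambert_term_def divide_simps) (simp add: power2_eq_square algebra_simps)
  qed
  have p2: "norm (p ^ 2) < 1"
    using p by (simp add: norm_power power_less_one_iff)
  have "lambert p x + lambert p (-x) = (\<Sum>n. lambert_term (x * p ^ n) + lambert_term (- x * p ^ n))"
    unfolding lambert_def by (intro suminf_add summable_lambert p)
  also have "\<dots> = (\<Sum>n. 4 * lambert_term (x ^ 2 * (p ^ 2) ^ n))"
    using eq[OF ne] by (simp add: power_mult_distrib power_even_eq mult_ac flip: power_mult)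
  also have "\<dots> = 4 * lambert (p ^ 2) (x ^ 2)"
    unfolding lambert_def by (intro suminf_mult summable_lambert p2)
  finally show ?thesis .
qed

text \<open>Summing over the cube roots of unity keeps every third term of the same power series,
  with factor \<open>3 * 3\<close>.\<close>

lemma lambert_add_cubic:
  assumes p: "norm p < 1" and w: "w ^ 2 + w + 1 = 0" and ne: "\<And>n. (x * p ^ n) ^ 3 \<noteq> 1"
  shows "lambert p x + lambert p (w * x) + lambert p (w ^ 2 * x) = 9 * lambert (p ^ 3) (x ^ 3)"
proof -
  have eq: "lambert_term y + lambert_term (w * y) + lambert_term (w ^ 2 * y) = 9 * lambert_term (y ^ 3)"
    if "y ^ 3 \<noteq> 1" for y
  proof -
    have fac: "1 - y ^ 3 = (1 - y) * (1 - w * y) * (1 - w ^ 2 * y)"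
      using w by algebra
    have ne: "1 - y \<noteq> 0" "1 - w * y \<noteq> 0" "1 - w ^ 2 * y \<noteq> 0"
      using that fac by auto
    define A B C where "A = 1 - y" and "B = 1 - w * y" and "C = 1 - w ^ 2 * y"
    have *: "y * (B * C) ^ 2 + w * y * (A * C) ^ 2 + w ^ 2 * y * (A * B) ^ 2 = 9 * y ^ 3"
      unfolding A_def B_def C_def using w by algebra
    have "lambert_term y + lambert_term (w * y) + lambert_term (w ^ 2 * y)
        = (y * (B * C) ^ 2 + w * y * (A * C) ^ 2 + w ^ 2 * y * (A * B) ^ 2) / (A * B * C) ^ 2"
      using ne unfolding lambert_term_def A_def[symmetric] B_def[symmetric] C_def[symmetric]
      by (simp add: add_divide_distrib power_mult_distrib)
    then show ?thesis
      unfolding * by (simp add: lambert_term_def fac A_def B_def C_def)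
  qed
  have p3: "norm (p ^ 3) < 1"
    using p by (simp add: norm_power power_less_one_iff)
  have "lambert p x + lambert p (w * x) + lambert p (w ^ 2 * x)
      = (\<Sum>n. lambert_term (x * p ^ n) + lambert_term (w * x * p ^ n) + lambert_term (w ^ 2 * x * p ^ n))"
    unfolding lambert_def by (simp add: suminf_add summable_add summable_lambert p)
  also have "\<dots> = (\<Sum>n. 9 * lambert_term (x ^ 3 * (p ^ 3) ^ n))"
    using eq[OF ne] by (simp add: power_mult_distrib mult_ac flip: power_mult)
  also have "\<dots> = 9 * lambert (p ^ 3) (x ^ 3)"
    unfolding lambert_def by (intro suminf_mult summable_lambert p3)
  finally show ?thesis .
qed

lemma holomorphic_lambert:
  assumes p: "norm p < 1"
  shows "lambert p holomorphic_on ball 0 1"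
proof -
  have norm_less: "norm (x * p ^ n) < 1" if "norm x < 1" for x n
    using mult_left_le[of "norm p ^ n" "norm x"] p that
    by (simp add: norm_mult norm_power power_le_one)
  have "\<exists>g. \<forall>x\<in>ball 0 1. (\<lambda>n. lambert_term (x * p ^ n)) sums g x \<and> g field_differentiable at x"
  proof (rule series_differentiable_comparison_complex[of "ball 0 1" "\<lambda>n x. lambert_term (x * p ^ n)"])
    show "(\<lambda>x. lambert_term (x * p ^ n)) field_differentiable at x" if "x \<in> ball 0 1" for n x
      using norm_less[of x n] that unfolding lambert_term_def
      by (intro derivative_intros) auto
    fix x :: complex assume x: "x \<in> ball 0 1"
    \<comment> \<open>A small ball around \<open>x\<close> stays within radius \<open>r < 1\<close>,
      where every denominator has norm at least \<open>(1 - r) ^ 2\<close>.\<close>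
    define r where "r = (1 + norm x) / 2"
    have r: "norm x < r" "r < 1" "0 \<le> r"
      using x by (auto simp: r_def)
    define h where "h = (\<lambda>n. complex_of_real (norm p ^ n / (1 - r) ^ 2))"
    have "norm (lambert_term (y * p ^ n)) \<le> norm (h n)" if "y \<in> ball x (r - norm x) \<inter> ball 0 1" for y n
    proof -
      have "norm y \<le> r"
        using that norm_triangle_ineq2[of y x] by (simp add: dist_norm norm_minus_commute)
      then have "norm (y * p ^ n) \<le> r" "norm (y * p ^ n) \<le> norm p ^ n"
        using mult_mono[of "norm y" r "norm p ^ n" 1] mult_right_mono[of "norm y" 1 "norm p ^ n"] p r
        by (auto simp: norm_mult norm_power power_le_one)
      then show ?thesis
        using norm_lambert_term_le[of "y * p ^ n" r] r
          divide_right_mono[of "norm (y * p ^ n)" "norm p ^ n" "(1 - r) ^ 2"]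
        by (simp add: h_def del: of_real_divide of_real_power)
    qed
    moreover have "summable h"
      unfolding h_def using p
      by (intro summable_of_real summable_divide summable_geometric) auto
    moreover have "range h \<subseteq> \<real>\<^sub>\<ge>\<^sub>0"
      by (auto simp: h_def nonneg_Reals_def simp del: of_real_divide of_real_power)
    ultimately show "\<exists>d (h :: nat \<Rightarrow> complex). 0 < d \<and> summable h \<and> range h \<subseteq> \<real>\<^sub>\<ge>\<^sub>0 \<and>
        (\<forall>\<^sub>F n in sequentially. \<forall>y\<in>ball x d \<inter> ball 0 1. norm (lambert_term (y * p ^ n)) \<le> norm (h n))"
      using r by (intro exI[of _ "r - norm x"] exI[of _ h]) (auto intro!: always_eventually)
  qed (rule open_ball, rule exI)
  then obtain g where g: "\<And>x. x \<in> ball 0 1 \<Longrightarrow> (\<lambda>n. lambert_term (x * p ^ n)) sums g x"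
      "\<And>x. x \<in> ball 0 1 \<Longrightarrow> g field_differentiable at x"
    by blast
  then have "g holomorphic_on ball 0 1"
    by (auto simp: holomorphic_on_def intro: field_differentiable_at_within)
  then show ?thesis
    by (rule holomorphic_transform) (use g in \<open>auto simp: lambert_def sums_iff\<close>)
qed

lemma holomorphic_lambert' [holomorphic_intros]:
  assumes "norm p < 1" "f holomorphic_on A" "\<And>z. z \<in> A \<Longrightarrow> norm (f z) < 1"
  shows "(\<lambda>z. lambert p (f z)) holomorphic_on A"
  using holomorphic_on_compose_gen[OF assms(2) holomorphic_lambert[OF assms(1)]] assms(3)
  by (simp add: o_def image_subset_iff)

section \<open>The difference of two Weierstrass functions\<close>

text \<open>The \<open>[a]\<close> of the overview: for \<open>0 < norm p < 1\<close> a theta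
  function on the nonzero numbers, with simple zeros exactly at the integer powers of
  \<open>p\<close>.\<close>

definition mtheta :: "complex \<Rightarrow> complex \<Rightarrow> complex" where
  "mtheta p a = qpoch_inf a p * qpoch_inf (p / a) p"

text \<open>Up to an additive constant and a scalar factor, this is the Weierstrass function of the lattice
  spanned by \<open>2 \<pi> \<i>\<close> and \<open>ln p\<close>, in the multiplicative variable \<open>a = exp z\<close>.\<close>

definition weier :: "complex \<Rightarrow> complex \<Rightarrow> complex" where
  "weier p a = lambert p a + lambert p (p / a)"

lemma mtheta_one [simp]: "norm p < 1 \<Longrightarrow> mtheta p 1 = 0"
  by (simp add: mtheta_def)

text \<open>Splits off \<open>1 - a\<close>, the only factor that can vanish for
  \<open>norm p < norm a < 1 / norm p\<close>.\<close>

lemma mtheta_eq: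
  assumes "norm p < 1"
  shows "mtheta p a = (1 - a) * qpoch_inf (a * p) p * qpoch_inf (p / a) p"
  using qpoch_inf_rec[OF assms, of a] by (simp add: mtheta_def)

text \<open>The shift removes \<open>1 - a\<close> from one product and adds
  \<open>1 - 1 / a\<close> to the other; the quotient of these is \<open>- 1 / a\<close>.\<close>

lemma mtheta_mult_period:
  assumes "norm p < 1" "p \<noteq> 0" "a \<noteq> 0"
  shows "mtheta p (a * p) = - mtheta p a / a"
proof -
  have "mtheta p (a * p) = qpoch_inf (a * p) p * ((1 - 1 / a) * qpoch_inf (p / a) p)"
    using assms qpoch_inf_rec[of p "1 / a"] by (simp add: mtheta_def)
  also have "\<dots> = - ((1 - a) * qpoch_inf (a * p) p * qpoch_inf (p / a) p) / a"
    using assms by (simp add: field_simps)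
  finally show ?thesis
    by (simp only: mtheta_eq[OF assms(1), of a])
qed

lemma mtheta_nonzero:
  assumes p: "norm p < 1" "p \<noteq> 0" and a: "norm p < norm a" "norm a < 1 / norm p" "a \<noteq> 1"
  shows "mtheta p a \<noteq> 0"
proof -
  have "a \<noteq> 0"
    using a by auto
  have "qpoch_inf (a * p) p \<noteq> 0" "qpoch_inf (p / a) p \<noteq> 0"
    by (rule qpoch_inf_nonzero'[OF p(1)]; use p a \<open>a \<noteq> 0\<close> in \<open>simp add: norm_mult norm_divide field_simps\<close>)+
  then show ?thesis
    using a by (simp add: mtheta_eq[OF p(1)])
qed

lemma weier_eq:
  assumes "norm p < 1"
  shows "weier p a = lambert_term a + lambert p (a * p) + lambert p (p / a)"
  using lambert_rec[OF assms, of a] by (simp add: weier_def)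

text \<open>The shift moves one term between the halves of the bilateral series, and the symmetry of
  \<open>lambert_term\<close> matches it.\<close>

lemma weier_mult_period:
  assumes "norm p < 1" "p \<noteq> 0" "a \<noteq> 0"
  shows "weier p (a * p) = weier p a"
  using assms lambert_rec[of p "1 / a"] weier_eq[of p a] lambert_term_inverse[of a]
  by (simp add: weier_def field_simps)

text \<open>Fix \<open>b\<close> and let \<open>a = z\<close> vary in an annulus whose only singular
  point is 1. Once that singularity is removed, periodicity gives the modulus of the difference an
  interior maximum, so the difference is constant.\<close>

theorem weier_diff:
  assumes p: "norm p < 1" "p \<noteq> 0"
    and a: "norm p < norm a" "norm a < 1 / norm p" "a \<noteq> 1"
    and b: "norm p < norm b" "norm b < 1 / norm p" "b \<noteq> 1"
  shows "weier p a - weier p b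
       = qpoch_inf p p ^ 4 * a * mtheta p (a * b) * mtheta p (b / a) / (mtheta p a ^ 2 * mtheta p b ^ 2)"
proof -
  define U where "U = {z :: complex. norm p < norm z \<and> norm z < 1 / norm p}"
  have conn: "connected U"
    using connected_annulus(1)[where a = "0 :: complex" and ?r1.0 = "norm p" and ?r2.0 = "1 / norm p"]
    by (simp add: U_def)
  have opn: "open U"
    unfolding U_def by (intro open_Collect_conj open_Collect_less continuous_intros)
  have inv_p: "1 < 1 / norm p"
    using p by simp
  have U: "1 \<in> U" "a \<in> U" "b \<in> U"
    using p a b inv_p by (auto simp: U_def)
  have nz: "z \<noteq> 0" if "z \<in> U" for z
    using that by (auto simp: U_def)
  have "b \<noteq> 0"
    using nz U by blast
  define \<phi> where "\<phi> = (\<lambda>x. qpoch_inf x p)"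
  have \<phi>_nz: "\<phi> (z * p) \<noteq> 0" "\<phi> (p / z) \<noteq> 0" if "z \<in> U" for z
    unfolding \<phi>_def
    by (rule qpoch_inf_nonzero'[OF p(1)];
        use p that nz[OF that] in \<open>simp add: U_def norm_mult norm_divide field_simps\<close>)+
  have \<theta>b: "mtheta p b \<noteq> 0"
    by (rule mtheta_nonzero[OF p b])
  \<comment> \<open>The right-hand side becomes \<open>z * M z / (1 - z) ^ 2\<close>;
    \<open>h\<close> measures how far it is from \<open>lambert_term z\<close> near the
    pole.\<close>
  define K where "K = qpoch_inf p p ^ 4 / mtheta p b ^ 2"
  define M where "M = (\<lambda>z. K * mtheta p (z * b) * mtheta p (b / z) / (\<phi> (z * p) ^ 2 * \<phi> (p / z) ^ 2))"
  define h where "h = (\<lambda>z. 1 - M z)"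
  have h_hol: "h holomorphic_on U"
    unfolding h_def M_def mtheta_def
    using \<phi>_nz nz \<open>b \<noteq> 0\<close> unfolding \<phi>_def
    by (intro holomorphic_intros p) auto
  \<comment> \<open>The factor \<open>qpoch_inf p p ^ 4\<close> normalises \<open>M 1\<close> to
    1.\<close>
  have h1: "h 1 = 0"
    using \<theta>b \<phi>_nz[OF U(1)] by (simp add: h_def M_def K_def \<phi>_def power2_eq_square power4_eq_xxxx)
  \<comment> \<open>Inversion swaps the two numerator thetas and the two denominator
    factors.\<close>
  have h_inv: "h (1 / z) = h z" for z
    by (simp add: h_def M_def mult_ac)
  have dh1: "deriv h 1 = 0"
  proof -
    have d: "(h has_field_derivative deriv h 1) (at (1 / 1))"
      using h_hol opn U(1) by (simp add: holomorphic_derivI)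
    have "((\<lambda>z. h (1 / z)) has_field_derivative deriv h 1 * (- 1)) (at 1)"
      by (rule DERIV_chain2[where f = h and g = "\<lambda>z. 1 / z" and x = 1, OF d]) (auto intro!: derivative_eq_intros)
    then have "(h has_field_derivative - deriv h 1) (at 1)"
      by (simp add: h_inv)
    then have "deriv h 1 = - deriv h 1"
      by (rule DERIV_imp_deriv)
    then show ?thesis
      by simp
  qed
  \<comment> \<open>The symmetry of \<open>h\<close> makes its zero at 1 a double one, so the double poles of the two sides cancel.\<close>
  define h' where "h' = (\<lambda>z. if z = 1 then deriv h 1 else (h z - h 1) / (z - 1))"
  define h'' where "h'' = (\<lambda>z. if z = 1 then deriv h' 1 else (h' z - h' 1) / (z - 1))"
  have int: "1 \<in> interior U"
    using U(1) opn by (simp add: interior_open)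
  have "h' holomorphic_on U"
    unfolding h'_def by (rule pole_lemma[OF h_hol int])
  then have h''_hol: "h'' holomorphic_on U"
    unfolding h''_def by (rule pole_lemma[OF _ int])
  have h'': "h'' z = h z / (1 - z) ^ 2" if "z \<noteq> 1" for z
    using that h1 dh1 by (simp add: h''_def h'_def power2_commute[of 1 z]) (simp add: power2_eq_square)
  \<comment> \<open>\<open>z * h'' z\<close> extends \<open>lambert_term z - R z\<close>
    holomorphically over 1, so \<open>D\<close> is the difference of the two sides with its
    singularity removed.\<close>
  define D where "D = (\<lambda>z. z * h'' z + lambert p (z * p) + lambert p (p / z) - weier p b)"
  define R where "R = (\<lambda>z. K * z * mtheta p (z * b) * mtheta p (b / z) / mtheta p z ^ 2)"
  have D_eq: "D z = weier p z - weier p b - R z" if "z \<in> U" "z \<noteq> 1" for z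
  proof -
    have "mtheta p z = (1 - z) * \<phi> (z * p) * \<phi> (p / z)"
      by (simp add: \<phi>_def mtheta_eq[OF p(1)])
    then have "z * M z / (1 - z) ^ 2 = R z"
      by (simp add: M_def R_def power_mult_distrib mult_ac)
    then have "z * h'' z = lambert_term z - R z"
      using that by (simp add: h'' h_def lambert_term_def diff_divide_distrib right_diff_distrib)
    then show ?thesis
      by (simp add: D_def weier_eq[OF p(1), of z])
  qed
  \<comment> \<open>The shift multiplies \<open>z\<close> by \<open>p\<close> and the numerator
    thetas by \<open>- 1 / (z * b)\<close> and \<open>- b / (z * p)\<close>; the product
    \<open>1 / z ^ 2\<close> is also the multiplier of \<open>mtheta p z ^ 2\<close>.\<close>
  have R_period: "R (z * p) = R z" if "z \<noteq> 0" for z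
  proof -
    have 1: "mtheta p (z * p * b) = - mtheta p (z * b) / (z * b)"
      using mtheta_mult_period[OF p, of "z * b"] that \<open>b \<noteq> 0\<close> by (simp add: mult_ac)
    have 2: "mtheta p (b / (z * p)) = - (b / (z * p)) * mtheta p (b / z)"
      using mtheta_mult_period[OF p, of "b / (z * p)"] that \<open>b \<noteq> 0\<close> p by (simp add: field_simps)
    show ?thesis
      unfolding R_def 1 2 mtheta_mult_period[OF p that]
      using that \<open>b \<noteq> 0\<close> p by (simp add: field_simps power2_eq_square)
  qed
  \<comment> \<open>The bounds put both \<open>z\<close> and \<open>z * p\<close> into
    \<open>U\<close> and away from 1.\<close>
  have D_period: "D (z * p) = D z" if "1 < norm z" "norm z < 1 / norm p" for z
  proof -
    have "norm p < norm (z * p)" "norm (z * p) < 1"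
      using that p by (auto simp: norm_mult field_simps)
    then have "z \<in> U" "z \<noteq> 1" "z * p \<in> U" "z * p \<noteq> 1" "z \<noteq> 0"
      using that p inv_p by (auto simp: U_def)
    then show ?thesis
      by (simp add: D_eq R_period weier_mult_period p)
  qed
  have "norm (z * p) < 1 \<and> norm (p / z) < 1" if "z \<in> U" for z
    using that nz[OF that] p by (auto simp: U_def norm_mult norm_divide field_simps)
  then have D_hol: "D holomorphic_on U"
    unfolding D_def using nz by (intro holomorphic_intros h''_hol p) auto
  \<comment> \<open>Every value of \<open>D\<close> on \<open>U\<close> is taken on the compact annulus \<open>A\<close>, which holds a full period.\<close>
  define r where "r = sqrt (norm p)"
  have r: "r * r = norm p" "0 < r" "r < 1"
    using p by (auto simp: r_def)
  have r': "norm p < r"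
    using r mult_strict_left_mono[of r 1 r] by simp
  have inv_r: "1 < 1 / r" "1 / r < 1 / norm p"
    using r r' p by (simp_all add: field_simps)
  define A where "A = {z :: complex. r \<le> norm z \<and> norm z \<le> 1 / r}"
  have "A = cball 0 (1 / r) - ball 0 r"
    by (auto simp: A_def)
  then have "compact A"
    by (simp add: compact_diff)
  moreover have "A \<subseteq> U"
    using r' inv_r(2) by (auto simp: A_def U_def)
  moreover have "A \<noteq> {}"
    using r by (auto simp: A_def intro!: exI[of _ 1])
  moreover have "continuous_on A (\<lambda>z. norm (D z))"
    using D_hol \<open>A \<subseteq> U\<close>
    by (intro continuous_on_norm) (metis continuous_on_subset holomorphic_on_imp_continuous_on)
  ultimately obtain \<xi> where \<xi>: "\<xi> \<in> A" "\<And>z. z \<in> A \<Longrightarrow> norm (D z) \<le> norm (D \<xi>)"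
    using continuous_attains_sup[of A "\<lambda>z. norm (D z)"]
    by blast
  have "norm (D z) \<le> norm (D \<xi>)" if "z \<in> U" for z
  proof -
    consider "z \<in> A" | "norm z < r" | "1 / r < norm z"
      by (force simp: A_def)
    then have "\<exists>w\<in>A. D z = D w"
    proof cases
      case 2
      have "D (z / p * p) = D (z / p)"
        using that 2 p r by (intro D_period) (auto simp: U_def norm_divide divide_strict_right_mono)
      moreover have "1 < norm (z / p)"
        using that p by (simp add: U_def norm_divide)
      moreover have "norm (z / p) < 1 / r"
        using 2 r p by (simp add: norm_divide field_simps flip: r(1))
      ultimately have "D (z / p * p) = D (z / p)" "z / p \<in> A"
        using r by (auto simp: A_def)
      then show ?thesis
        using p by auto
    next
      case 3
      have "D (z * p) = D z"
        using that 3 inv_r by (intro D_period) (auto simp: U_def)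
      moreover have "norm (z * p) < 1"
        using that p by (simp add: U_def norm_mult field_simps)
      moreover have "r < norm (z * p)"
        using 3 r by (simp add: norm_mult field_simps flip: r(1))
      ultimately have "D (z * p) = D z" "z * p \<in> A"
        using inv_r by (auto simp: A_def)
      then show ?thesis
        by metis
    qed auto
    then show ?thesis
      using \<xi> by auto
  qed
  then have "D constant_on U"
    using \<xi>(1) \<open>A \<subseteq> U\<close> by (intro maximum_modulus_principle[OF D_hol opn conn opn order_refl]) auto
  then have "D a = D b"
    using U by (metis constant_on_def)
  \<comment> \<open>\<open>R b\<close> contains the factor
    \<open>mtheta p (b / b) = mtheta p 1 = 0\<close>.\<close>
  moreover have "D b = 0"
    using U b p \<open>b \<noteq> 0\<close> by (simp add: D_eq R_def)
  ultimately have "weier p a - weier p b = R a"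
    using U a by (simp add: D_eq)
  then show ?thesis
    by (simp add: R_def K_def mult_ac)
qed

section \<open>Ramanujan's function psi and Lambert series\<close>

text \<open>Gauss's product for the theta series with exponents \<open>n * (n + 1) / 2\<close>;
  Gosper's function is \<open>q^(1/4)\<close> times its square.\<close>

definition ramanujan_psi :: "complex \<Rightarrow> complex" where
  "ramanujan_psi q = qpoch_inf (q ^ 2) (q ^ 2) / qpoch_inf q (q ^ 2)"

lemma norm_power_less_norm_power:
  fixes q :: complex
  assumes "q \<noteq> 0" "norm q < 1" "m < n"
  shows "norm (q ^ n) < norm (q ^ m)"
  using assms by (simp add: norm_power power_strict_decreasing)

lemma weier_diff_unit_disc:
  assumes "norm p < 1" "p \<noteq> 0"
    and "norm p < norm a" "norm a \<le> 1" "a \<noteq> 1"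
    and "norm p < norm b" "norm b \<le> 1" "b \<noteq> 1"
  shows "weier p a - weier p b
       = qpoch_inf p p ^ 4 * a * mtheta p (a * b) * mtheta p (b / a) / (mtheta p a ^ 2 * mtheta p b ^ 2)"
proof (rule weier_diff)
  have "1 < 1 / norm p"
    using assms by simp
  then show "norm a < 1 / norm p" "norm b < 1 / norm p"
    using assms by linarith+
qed (use assms in auto)

lemma power_mult_neq_1:
  fixes x p :: complex
  assumes "norm x < 1" "norm p < 1" "k > 0"
  shows "(x * p ^ n) ^ k \<noteq> 1"
proof -
  have "norm (x * p ^ n) \<le> norm x * 1"
    unfolding norm_mult norm_power using assms by (intro mult_left_mono power_le_one) auto
  then have "norm ((x * p ^ n) ^ k) < 1"
    unfolding norm_power using assms by (intro power_less_one_iff[THEN iffD2]) auto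
  then show ?thesis
    by force
qed

text \<open>The odd exponents are all exponents minus the even ones.\<close>

lemma lambert_odd:
  assumes "norm q < 1"
  shows "lambert (q ^ 2) q = lambert q q - lambert (q ^ 2) (q ^ 2)"
  using lambert_bisect[of q q] assms by (simp add: power2_eq_square)

context
  fixes q :: complex
  assumes q: "norm q < 1" "q \<noteq> 0"
begin

private lemma norm_q: "k > 0 \<Longrightarrow> norm (q ^ k) < 1"
  using q by (auto simp: norm_power power_less_one_iff)

private lemma q_neq_1: "k > 0 \<Longrightarrow> q ^ k \<noteq> 1"
  using norm_q[of k] by force

private lemma qpoch_inf_q_nonzero: "k > 0 \<Longrightarrow> m > 0 \<Longrightarrow> qpoch_inf (q ^ m) (q ^ k) \<noteq> 0"
  by (intro qpoch_inf_nonzero' norm_q)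

text \<open>The instance \<open>a = q\<close>, \<open>b = -q\<close>, \<open>p = q ^ 4\<close>; it
  yields the square of Gosper's function at \<open>q ^ 2\<close>.\<close>

lemma psi_power4_eq_lambert:
  "q * ramanujan_psi (q ^ 2) ^ 4
     = lambert q q - 3 * lambert (q ^ 2) (q ^ 2) + 2 * lambert (q ^ 4) (q ^ 4)"
proof -
  define \<phi> where "\<phi> = (\<lambda>a. qpoch_inf a (q ^ 4))"
  define c e where "c = \<phi> (q ^ 2)" and "e = \<phi> (q ^ 4)"
  have nz: "c \<noteq> 0" "e \<noteq> 0"
    by (simp_all add: c_def e_def \<phi>_def qpoch_inf_q_nonzero)
  have psi: "ramanujan_psi (q ^ 2) = e / c"
    by (simp add: ramanujan_psi_def c_def e_def \<phi>_def flip: power_mult)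
  have div: "q ^ 4 / q = q ^ 3" "q ^ 4 / q ^ 2 = q ^ 2"
    using q power_diff[of q 1 4] power_diff[of q 2 4] by simp_all
  \<comment> \<open>Factors of opposite sign merge to base \<open>q ^ 8\<close>, and the two
    resulting products interleave to \<open>c\<close>.\<close>
  have "mtheta (q ^ 4) q * mtheta (q ^ 4) (- q) = (\<phi> q * \<phi> (- q)) * (\<phi> (q ^ 3) * \<phi> (- (q ^ 3)))"
    by (simp add: mtheta_def \<phi>_def div)
  also have "\<dots> = qpoch_inf (q ^ 2) (q ^ 8) * qpoch_inf (q ^ 6) (q ^ 8)"
    by (simp add: \<phi>_def qpoch_inf_mult_neg norm_q flip: power_mult)
  also have "\<dots> = c"
    using qpoch_inf_bisect[of "q ^ 4" "q ^ 2"] norm_q[of 4]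
    by (simp add: c_def \<phi>_def flip: power_mult power_add)
  finally have c: "mtheta (q ^ 4) q * mtheta (q ^ 4) (- q) = c" .
  \<comment> \<open>Euler's identity \<open>(-Q;Q) = 1 / (Q;Q^2)\<close> with
    \<open>Q = q ^ 2\<close>, read off from \<open>(Q;Q) * (-Q;Q) = (Q^2;Q^2)\<close>.\<close>
  have "c * e = qpoch_inf (q ^ 2) (q ^ 2)"
    using qpoch_inf_bisect[of "q ^ 2" "q ^ 2"] norm_q[of 2]
    by (simp add: c_def e_def \<phi>_def flip: power_mult power_add)
  moreover have "\<phi> (- (q ^ 2)) * \<phi> (- (q ^ 4)) = qpoch_inf (- (q ^ 2)) (q ^ 2)"
    using qpoch_inf_bisect[of "q ^ 2" "- (q ^ 2)"] norm_q[of 2]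
    by (simp add: \<phi>_def flip: power_mult power_add)
  moreover have "qpoch_inf (q ^ 2) (q ^ 2) * qpoch_inf (- (q ^ 2)) (q ^ 2) = e"
    by (simp add: e_def \<phi>_def qpoch_inf_mult_neg norm_q flip: power_mult)
  ultimately have "(c * e) * (\<phi> (- (q ^ 2)) * \<phi> (- (q ^ 4))) = e"
    by (simp only:)
  then have "\<phi> (- (q ^ 2)) * \<phi> (- (q ^ 4)) = 1 / c"
    using nz by (simp add: field_simps)
  moreover have "mtheta (q ^ 4) (- (q ^ 2)) = \<phi> (- (q ^ 2)) ^ 2"
    by (simp add: mtheta_def \<phi>_def div power2_eq_square[of "qpoch_inf _ _"])
  moreover have "mtheta (q ^ 4) (- 1) = 2 * \<phi> (- (q ^ 4)) ^ 2"
    by (simp add: mtheta_eq norm_q \<phi>_def power2_eq_square)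
  ultimately have m: "mtheta (q ^ 4) (- (q ^ 2)) * mtheta (q ^ 4) (- 1) = 2 / c ^ 2"
    by (metis (no_types, lifting) mult.left_commute power_mult_distrib power_one_over times_divide_eq_right mult.right_neutral)
  have "weier (q ^ 4) q - weier (q ^ 4) (- q)
      = e ^ 4 * q * mtheta (q ^ 4) (q * - q) * mtheta (q ^ 4) (- q / q)
        / (mtheta (q ^ 4) q ^ 2 * mtheta (q ^ 4) (- q) ^ 2)"
    unfolding e_def \<phi>_def
    using q norm_q[of 4] norm_power_less_norm_power[of q 1 4]
    by (intro weier_diff_unit_disc) (auto dest: arg_cong[of _ _ norm])
  also have "\<dots> = e ^ 4 * q * (mtheta (q ^ 4) (- (q ^ 2)) * mtheta (q ^ 4) (- 1))
        / (mtheta (q ^ 4) q * mtheta (q ^ 4) (- q)) ^ 2"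
    using q by (simp add: power_mult_distrib mult_ac flip: power2_eq_square)
  also have "\<dots> = 2 * (q * ramanujan_psi (q ^ 2) ^ 4)"
    unfolding m c psi using nz by (simp add: field_simps flip: power_add)
  finally have diff: "2 * (q * ramanujan_psi (q ^ 2) ^ 4) = weier (q ^ 4) q - weier (q ^ 4) (- q)"
    by simp
  have w: "weier (q ^ 4) q = lambert (q ^ 4) q + lambert (q ^ 4) (q ^ 3)"
    "weier (q ^ 4) (- q) = lambert (q ^ 4) (- q) + lambert (q ^ 4) (- (q ^ 3))"
    by (simp_all add: weier_def div)
  \<comment> \<open>Twice the \<open>weier\<close> value at \<open>q\<close> minus the sum over both
    signs gives \<open>2 * lambert (q ^ 2) q - 4 * lambert (q ^ 4) (q ^ 2)\<close>.\<close>
  have "lambert (q ^ 4) q + lambert (q ^ 4) (q ^ 3) = lambert (q ^ 2) q"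
    using lambert_bisect[of "q ^ 2" q] norm_q[of 2]
    by (simp flip: power_mult power_Suc)
  moreover have "lambert (q ^ 4) q + lambert (q ^ 4) (- q) = 4 * lambert (q ^ 8) (q ^ 2)"
    using lambert_add_neg[of "q ^ 4" q] norm_q[of 4] q power_mult_neq_1
    by (simp flip: power_mult)
  moreover have "lambert (q ^ 4) (q ^ 3) + lambert (q ^ 4) (- (q ^ 3)) = 4 * lambert (q ^ 8) (q ^ 6)"
    using lambert_add_neg[of "q ^ 4" "q ^ 3"] norm_q[of 4] power_mult_neq_1[OF norm_q[of 3] norm_q[of 4]]
    by (simp flip: power_mult)
  moreover have "lambert (q ^ 8) (q ^ 2) + lambert (q ^ 8) (q ^ 6) = lambert (q ^ 4) (q ^ 2)"
    using lambert_bisect[of "q ^ 4" "q ^ 2"] norm_q[of 4]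
    by (simp flip: power_mult power_add)
  moreover have "lambert (q ^ 4) (q ^ 2) = lambert (q ^ 2) (q ^ 2) - lambert (q ^ 4) (q ^ 4)"
    using lambert_odd[of "q ^ 2"] norm_q[of 2] by (simp flip: power_mult)
  ultimately show ?thesis
    using diff lambert_odd[OF q(1)] unfolding w by algebra
qed

section \<open>Theta quotients and Lambert series to the base \<open>q ^ 6\<close>\<close>

private abbreviation "c k \<equiv> qpoch_inf (q ^ k) (q ^ 6)"

private lemma mtheta_power_6: "k \<le> 6 \<Longrightarrow> mtheta (q ^ 6) (q ^ k) = c k * c (6 - k)"
  using q by (simp add: mtheta_def power_diff)

text \<open>In the common base both functions are monomials in the \<open>c k\<close>, directly
  comparable with theta quotients.\<close>

private lemma psi_base_6:
  "ramanujan_psi q = c 2 * c 4 * c 6 / (c 1 * c 3 * c 5)" "ramanujan_psi (q ^ 3) = c 6 / c 3"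
  using qpoch_inf_trisect[of "q ^ 2" q] qpoch_inf_trisect[of "q ^ 2" "q ^ 2"] norm_q[of 2]
  by (simp_all add: ramanujan_psi_def flip: power_mult power_add power_Suc)

private lemma weier_diff_power:
  assumes "0 < m" "m < n" "n < 6"
  shows "weier (q ^ 6) (q ^ m) - weier (q ^ 6) (q ^ n)
    = c 6 ^ 4 * q ^ m * mtheta (q ^ 6) (q ^ (m + n)) * mtheta (q ^ 6) (q ^ (n - m))
      / (mtheta (q ^ 6) (q ^ m) ^ 2 * mtheta (q ^ 6) (q ^ n) ^ 2)"
  using assms q weier_diff_unit_disc[of "q ^ 6" "q ^ m" "q ^ n"] norm_q[of 6] norm_q[of m] norm_q[of n]
    q_neq_1 norm_power_less_norm_power[of q m 6] norm_power_less_norm_power[of q n 6]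
  by (simp add: power_add power_diff)

text \<open>Residues mod 6 are grouped by their greatest common divisor with 6, the classes that
  \<open>k\<close> and \<open>6 - k\<close> share; the units 1 and 5 follow by
  inclusion-exclusion.\<close>

private lemma lambert_base_6:
  "lambert (q ^ 6) (q ^ 3) = lambert (q ^ 3) (q ^ 3) - lambert (q ^ 6) (q ^ 6)"
  "lambert (q ^ 6) (q ^ 2) + lambert (q ^ 6) (q ^ 4) = lambert (q ^ 2) (q ^ 2) - lambert (q ^ 6) (q ^ 6)"
  "lambert (q ^ 6) q + lambert (q ^ 6) (q ^ 5)
    = lambert q q - lambert (q ^ 2) (q ^ 2) - lambert (q ^ 3) (q ^ 3) + lambert (q ^ 6) (q ^ 6)"
proof -
  show 1: "lambert (q ^ 6) (q ^ 3) = lambert (q ^ 3) (q ^ 3) - lambert (q ^ 6) (q ^ 6)"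
    using lambert_odd[of "q ^ 3"] norm_q[of 3] by (simp flip: power_mult)
  show "lambert (q ^ 6) (q ^ 2) + lambert (q ^ 6) (q ^ 4) = lambert (q ^ 2) (q ^ 2) - lambert (q ^ 6) (q ^ 6)"
    using lambert_trisect[of "q ^ 2" "q ^ 2"] norm_q[of 2]
    by (simp flip: power_mult power_add)
  have "lambert (q ^ 2) q = lambert (q ^ 6) q + lambert (q ^ 6) (q ^ 3) + lambert (q ^ 6) (q ^ 5)"
    using lambert_trisect[of "q ^ 2" q] norm_q[of 2]
    by (simp flip: power_mult power_add power_Suc)
  then show "lambert (q ^ 6) q + lambert (q ^ 6) (q ^ 5)
    = lambert q q - lambert (q ^ 2) (q ^ 2) - lambert (q ^ 3) (q ^ 3) + lambert (q ^ 6) (q ^ 6)"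
    using 1 lambert_odd[OF q(1)] by (simp add: algebra_simps)
qed

private lemma weier_power_6: "k \<le> 6 \<Longrightarrow> weier (q ^ 6) (q ^ k) = lambert (q ^ 6) (q ^ k) + lambert (q ^ 6) (q ^ (6 - k))"
  using q by (simp add: weier_def power_diff)

text \<open>The instance \<open>a = q\<close>, \<open>b = q ^ 3\<close>; with \<open>q ^ 2\<close>
  for \<open>q\<close> it evaluates \<open>A * B\<close>.\<close>

lemma psi_square_mult_psi_cube_square_eq_lambert:
  "q * ramanujan_psi q ^ 2 * ramanujan_psi (q ^ 3) ^ 2
     = lambert q q - lambert (q ^ 2) (q ^ 2) - 3 * lambert (q ^ 3) (q ^ 3) + 3 * lambert (q ^ 6) (q ^ 6)"
proof -
  have "weier (q ^ 6) (q ^ 1) - weier (q ^ 6) (q ^ 3)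
      = c 6 ^ 4 * q * (c 4 * c 2) * (c 2 * c 4) / ((c 1 * c 5) ^ 2 * (c 3 * c 3) ^ 2)"
    using weier_diff_power[of 1 3] mtheta_power_6[of 1] mtheta_power_6[of 2] mtheta_power_6[of 3] mtheta_power_6[of 4]
    by simp
  also have "\<dots> = q * (c 2 * c 4 * c 6 / (c 1 * c 3 * c 5)) ^ 2 * (c 6 / c 3) ^ 2"
    by (simp only: power_mult_distrib power_divide times_divide_eq_left times_divide_eq_right
        divide_divide_eq_left power4_eq_xxxx power2_eq_square mult_ac)
  finally have "q * ramanujan_psi q ^ 2 * ramanujan_psi (q ^ 3) ^ 2 = weier (q ^ 6) (q ^ 1) - weier (q ^ 6) (q ^ 3)"
    by (simp only: psi_base_6)
  then show ?thesis
    using weier_power_6[of 1] weier_power_6[of 3] lambert_base_6 by simp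
qed

text \<open>The instance \<open>a = q ^ 2\<close>, \<open>b = q ^ 3\<close>; with
  \<open>q ^ 2\<close> for \<open>q\<close> it evaluates \<open>B ^ 3 / A\<close>.\<close>

lemma psi_cube_power6_div_psi_square_eq_lambert:
  "q ^ 2 * ramanujan_psi (q ^ 3) ^ 6 / ramanujan_psi q ^ 2
     = lambert (q ^ 2) (q ^ 2) - 2 * lambert (q ^ 3) (q ^ 3) + lambert (q ^ 6) (q ^ 6)"
proof -
  have eq: "x * (a / d) ^ 6 / (b * a / (e * d)) ^ 2 = a ^ 4 * x * (e * e) / (b ^ 2 * (d * d) ^ 2)"
    if "a \<noteq> 0" "d \<noteq> 0" for a b d e x :: complex
    using that by (cases "b = 0 \<or> e = 0") (auto simp: field_simps eval_nat_numeral)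
  have "weier (q ^ 6) (q ^ 2) - weier (q ^ 6) (q ^ 3)
      = c 6 ^ 4 * q ^ 2 * ((c 1 * c 5) * (c 1 * c 5)) / ((c 2 * c 4) ^ 2 * (c 3 * c 3) ^ 2)"
    using weier_diff_power[of 2 3] mtheta_power_6[of 1] mtheta_power_6[of 2] mtheta_power_6[of 3] mtheta_power_6[of 5]
    by (simp add: mult_ac)
  also have "\<dots> = q ^ 2 * ramanujan_psi (q ^ 3) ^ 6 / ramanujan_psi q ^ 2"
    using eq[of "c 6" "c 3" "q ^ 2" "c 2 * c 4" "c 1 * c 5"] qpoch_inf_q_nonzero[of 6]
    by (simp add: psi_base_6 mult_ac)
  finally have "q ^ 2 * ramanujan_psi (q ^ 3) ^ 6 / ramanujan_psi q ^ 2 = weier (q ^ 6) (q ^ 2) - weier (q ^ 6) (q ^ 3)"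
    by (rule sym)
  then show ?thesis
    using weier_power_6[of 2] weier_power_6[of 3] lambert_base_6 by simp
qed

text \<open>The instance \<open>a = w\<close>, \<open>b = q\<close>, \<open>p = q ^ 2\<close> with a
  primitive cube root of unity \<open>w\<close>. The constant 1 is
  \<open>-3 * lambert_term w\<close>.\<close>

lemma psi_power6_div_psi_cube_square_eq_lambert:
  "ramanujan_psi q ^ 6 / ramanujan_psi (q ^ 3) ^ 2
     = 1 + 6 * lambert q q - 3 * lambert (q ^ 2) (q ^ 2) - 27 * lambert (q ^ 6) (q ^ 6)"
proof -
  define w where "w = cis (2 * pi / 3)"
  have w: "w ^ 2 + w + 1 = 0"
    by (simp add: w_def complex_eq_iff cos_120 sin_120 DeMoivre power2_eq_square)
  have w1: "w \<noteq> 1" and w0: "w \<noteq> 0" and w3: "w ^ 3 = 1" and norm_w: "norm w = 1"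
    using w by (auto simp: w_def) algebra
  have inv_w: "x / w = w ^ 2 * x" "x / w ^ 2 = w * x" for x
    using w0 w3 by (simp_all add: field_simps power2_eq_square power3_eq_cube)
  have lw: "w / (1 - w) ^ 2 = - 1 / 3"
  proof -
    have "(1 - w) ^ 2 = - 3 * w"
      using w by algebra
    then show ?thesis
      using w0 by simp
  qed
  define \<phi> where "\<phi> = (\<lambda>a. qpoch_inf a (q ^ 2))"
  define d e f g where "d = \<phi> q" and "e = \<phi> (q ^ 2)" and "f = c 3" and "g = c 6"
  have nz: "d \<noteq> 0" "e \<noteq> 0" "f \<noteq> 0" "g \<noteq> 0"
    using qpoch_inf_q_nonzero[of 2 1] qpoch_inf_q_nonzero[of 2 2] qpoch_inf_q_nonzero[of 6]
    by (simp_all add: d_def e_def f_def g_def \<phi>_def)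
  \<comment> \<open>The product over all three cube roots has base \<open>q ^ 6\<close>; dividing by
    the factor for the root 1 leaves the conjugate pair.\<close>
  have f: "\<phi> (w * q) * \<phi> (w ^ 2 * q) = f / d"
    using qpoch_inf_mult_cubic[OF norm_q[of 2] w, of q] nz
    by (simp add: d_def f_def \<phi>_def field_simps flip: power_mult)
  have g: "\<phi> (w * q ^ 2) * \<phi> (w ^ 2 * q ^ 2) = g / e"
    using qpoch_inf_mult_cubic[OF norm_q[of 2] w, of "q ^ 2"] nz
    by (simp add: e_def g_def \<phi>_def field_simps flip: power_mult)
  have "q ^ 2 / (w * q) = w ^ 2 * q" "q ^ 2 / (w ^ 2 * q) = w * q"
    using q inv_w[of q] w0 by (simp_all add: field_simps power2_eq_square)
  then have m: "mtheta (q ^ 2) (w * q) = f / d" "mtheta (q ^ 2) (w ^ 2 * q) = f / d"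
    unfolding mtheta_def f[symmetric] by (simp_all add: \<phi>_def)
  have mw: "mtheta (q ^ 2) w = (1 - w) * (g / e)"
    using norm_q[of 2] unfolding g[symmetric] by (simp add: mtheta_eq \<phi>_def inv_w)
  have mq: "mtheta (q ^ 2) q = d ^ 2"
    using q by (simp add: mtheta_def d_def \<phi>_def power2_eq_square)
  have "weier (q ^ 2) w - weier (q ^ 2) q
      = e ^ 4 * w * mtheta (q ^ 2) (w * q) * mtheta (q ^ 2) (q / w)
        / (mtheta (q ^ 2) w ^ 2 * mtheta (q ^ 2) q ^ 2)"
    unfolding e_def \<phi>_def
    using q q_neq_1[of 1] norm_q[of 2] norm_power_less_norm_power[of q 1 2] w1
    by (intro weier_diff_unit_disc) (auto simp: norm_w)
  also have "\<dots> = w / (1 - w) ^ 2 * (e ^ 4 * (f / d) ^ 2 / ((g / e) ^ 2 * (d ^ 2) ^ 2))"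
    unfolding inv_w m mw mq power_mult_distrib by (simp add: power2_eq_square[of f] power2_eq_square[of d] mult_ac power_divide)
  also have "\<dots> = - 1 / 3 * ((e / d) ^ 6 / (g / f) ^ 2)"
    unfolding lw using nz by (simp add: field_simps flip: power_add power_mult)
  also have "e / d = ramanujan_psi q"
    by (simp add: ramanujan_psi_def d_def e_def \<phi>_def)
  also have "g / f = ramanujan_psi (q ^ 3)"
    by (simp add: psi_base_6 f_def g_def)
  finally have diff: "ramanujan_psi q ^ 6 / ramanujan_psi (q ^ 3) ^ 2 = - 3 * (weier (q ^ 2) w - weier (q ^ 2) q)"
    by simp
  have "weier (q ^ 2) q = 2 * lambert (q ^ 2) q"
    using q by (simp add: weier_def power2_eq_square)
  moreover have "3 * weier (q ^ 2) w = - 1 + 3 * (lambert (q ^ 2) (w * q ^ 2) + lambert (q ^ 2) (w ^ 2 * q ^ 2))"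
    using norm_q[of 2] lw by (simp add: weier_eq lambert_term_def inv_w)
  moreover have "lambert (q ^ 2) (q ^ 2) + lambert (q ^ 2) (w * q ^ 2) + lambert (q ^ 2) (w ^ 2 * q ^ 2)
      = 9 * lambert (q ^ 6) (q ^ 6)"
    using lambert_add_cubic[OF norm_q[of 2] w, of "q ^ 2"] power_mult_neq_1[OF norm_q[of 2] norm_q[of 2]]
    by (simp flip: power_mult)
  ultimately show ?thesis
    unfolding diff lambert_odd[OF q(1)] by algebra
qed

end

section \<open>Gosper's function and the final linear combination\<close>

lemma gosper_Pi_eq_psi:
  assumes "q = exp (2 * of_real pi * \<i> * \<tau>)"
  shows "gosper_Pi (of_nat k * \<tau>) = exp (of_real pi * \<i> * of_nat k * \<tau> / 2) * ramanujan_psi (q ^ k) ^ 2"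
proof -
  have "nome_pow (of_nat k * \<tau>) 1 = q ^ k"
    by (simp add: nome_pow_def assms mult_ac flip: exp_of_nat_mult)
  then show ?thesis
    by (simp add: gosper_Pi_def Let_def ramanujan_psi_def power_divide nome_pow_def mult_ac)
qed

theorem theorem1p1:
  fixes \<tau> q :: complex
  assumes "Im \<tau> > 0"
    and "q = exp (2 * of_real pi * \<i> * \<tau>)"
  shows "1 / (gosper_Pi (6 * \<tau>))^2 *
           (24 * ((\<Sum>n. q ^ Suc n / (1 - q ^ Suc n)^2)
                  - 6 * (\<Sum>n. q ^ (6 * Suc n) / (1 - q ^ (6 * Suc n))^2)) + 5)
         = 5 * ((gosper_Pi (2 * \<tau>))^3 / (gosper_Pi (6 * \<tau>))^3)
           + 24 * ((gosper_Pi (2 * \<tau>))^2 / (gosper_Pi (6 * \<tau>))^2)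
           + 42 * (gosper_Pi (2 * \<tau>) / gosper_Pi (6 * \<tau>))
           + 9 * (gosper_Pi (6 * \<tau>) / gosper_Pi (2 * \<tau>))"
proof -
  have q: "norm q < 1" "q \<noteq> 0"
    using assms by auto
  have q2: "norm (q ^ 2) < 1" "q ^ 2 \<noteq> 0"
    using q by (auto simp: norm_power power_less_one_iff)
  \<comment> \<open>The square root of \<open>q\<close> fixed by \<tau>: the prefactors
    \<open>q^(1/2)\<close> of \<open>A\<close> and \<open>q^(3/2)\<close> of \<open>B\<close> are
    \<open>t\<close> and \<open>t ^ 3\<close>.\<close>
  define t where "t = exp (of_real pi * \<i> * \<tau>)"
  have t: "t ^ 2 = q" "t \<noteq> 0"
    by (auto simp: t_def assms mult_ac simp flip: exp_of_nat_mult)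
  define u v where "u = ramanujan_psi (q ^ 2)" and "v = ramanujan_psi (q ^ 6)"
  define A B where "A = gosper_Pi (2 * \<tau>)" and "B = gosper_Pi (6 * \<tau>)"
  have nz: "u \<noteq> 0" "v \<noteq> 0"
    unfolding u_def v_def ramanujan_psi_def using q
    by (simp_all add: qpoch_inf_nonzero' norm_power power_less_one_iff)
  have A: "A = t * u ^ 2"
    using gosper_Pi_eq_psi[OF assms(2), of 2] by (simp add: A_def t_def u_def mult_ac)
  have B: "B = t ^ 3 * v ^ 2"
    using gosper_Pi_eq_psi[OF assms(2), of 6] by (simp add: B_def t_def v_def mult_ac flip: exp_of_nat_mult)
  have AB: "A \<noteq> 0" "B \<noteq> 0"
    using t nz by (auto simp: A B)
  define S where "S = (\<lambda>k. lambert (q ^ k) (q ^ k))"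
  have sums: "(\<Sum>n. q ^ Suc n / (1 - q ^ Suc n)^2) = S 1"
      "(\<Sum>n. q ^ (6 * Suc n) / (1 - q ^ (6 * Suc n))^2) = S 6"
    by (simp_all add: S_def lambert_def lambert_term_def power_add flip: power_mult)
  have "A ^ 2 = q * u ^ 4"
    by (simp add: A power_mult_distrib t flip: power_mult)
  then have A2: "A ^ 2 = S 1 - 3 * S 2 + 2 * S 4"
    using psi_power4_eq_lambert[OF q] by (simp add: u_def S_def)
  have "A * B = q ^ 2 * u ^ 2 * v ^ 2"
    by (simp add: A B eval_nat_numeral flip: t)
  then have A1B1: "A * B = S 2 - S 4 - 3 * S 6 + 3 * S 12"
    using psi_square_mult_psi_cube_square_eq_lambert[OF q2] by (simp add: u_def v_def S_def flip: power_mult)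
  have "A ^ 3 / B = u ^ 6 / v ^ 2"
    using t nz by (simp add: A B field_simps flip: power_mult)
  then have A3: "A ^ 3 / B = 1 + 6 * S 2 - 3 * S 4 - 27 * S 12"
    using psi_power6_div_psi_cube_square_eq_lambert[OF q2] by (simp add: u_def v_def S_def flip: power_mult)
  have "B ^ 3 / A = (q ^ 2) ^ 2 * v ^ 6 / u ^ 2"
    using t(2) nz by (simp add: A B field_simps eval_nat_numeral flip: t(1))
  then have B3: "B ^ 3 / A = S 4 - 2 * S 6 + S 12"
    using psi_cube_power6_div_psi_square_eq_lambert[OF q2] by (simp add: u_def v_def S_def flip: power_mult)
  \<comment> \<open>The weights 5, 24, 42, 9 cancel \<open>S 2\<close>
    (\<open>30 - 72 + 42\<close>), \<open>S 4\<close> (\<open>-15 + 48 - 42 + 9\<close>) and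
    \<open>S 12\<close> (\<open>-135 + 126 + 9\<close>); \<open>S 6\<close> keeps
    \<open>-126 - 18 = -144\<close>.\<close>
  have "24 * (S 1 - 6 * S 6) + 5 = 5 * (A ^ 3 / B) + 24 * A ^ 2 + 42 * (A * B) + 9 * (B ^ 3 / A)"
    unfolding A2 A1B1 A3 B3 by simp
  also have "\<dots> = B ^ 2 * (5 * (A ^ 3 / B ^ 3) + 24 * (A ^ 2 / B ^ 2) + 42 * (A / B) + 9 * (B / A))"
    using AB by (simp add: field_simps eval_nat_numeral)
  finally show ?thesis
    unfolding sums A_def[symmetric] B_def[symmetric] using AB by simp
qed

end
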